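(* Consider the network utility maximization problem $\max_{x\in\mathcal X} f(x)=\sum_{i=1}^n f_i(x_i)$ subject to $Ax\le c$, with optimal value $f^\star$, and the Safe Dual Gradient Method (SDGM), both as defined in the context, under the standing assumptions stated there. Let $\gamma>0$ and for every $t\ge1$ let $$\gamma_-^t=\frac{\gamma}{\sqrt t},\qquad \Delta_j^t=\frac{[AA^Te_m]_j}{\mu}\,\gamma_-^t\ \ (j\in[m]),\qquad \gamma_+^t=(m-1)\gamma_-^t .$$ Then for all $t\ge1$ the iterates $x^t$ produced by the SDGM are feasible, i.e. $Ax^t\le c$. Furthermore, for all $T\ge 1$ the regret $R(T)=\sum_{t=1}^T\bigl(f^\star-f(x^t)\bigr)$ satisfies $$R(T)\le\frac{\overline\lambda^2\|c\|_1\sqrt T}{\gamma}+2C\gamma\sqrt T,$$ where $$C=\|c\|_1+\frac{\overline\lambda\, m\left(\|A^Te_m\|^2+\rho(A^TA)(m-1)^2/\mu\right)}{\mu}$$ and $\rho(A^TA)$ is the spectral radius of the matrix $A^TA$.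
   Context: Notation. $[n]=\{1,\dots,n\}$; $[v]_i$ or $v_i$ is the $i$-th entry of a vector $v$; vector inequalities are element-wise; $\mathbb R_+$ is the set of non-negative reals; $\|\cdot\|$ is the Euclidean norm and $\|\cdot\|_1$ the 1-norm; $e_m\in\mathbb R^m$ is the all-ones vector. Problem. Let $n,m$ be positive integers, $A\in\{0,1\}^{m\times n}$, $c\in\mathbb R_+^m$, and $\mathcal X=\mathcal X_1\times\cdots\times\mathcal X_n$ with $\mathcal X_i=[\underline x_i,\overline x_i]$, where $\underline x_i\ge 0$ and $\overline x_i=\infty$ is allowed. For each $i\in[n]$, $f_i$ is a strictly increasing, concave, differentiable utility function. The problem is $$\max_{x\in\mathcal X} f(x)=\sum_{i=1}^n f_i(x_i)\quad\text{subject to } Ax\le c ,$$ and $f^\star$ denotes its optimal objective value. The feasible region is $\overline{\mathcal X}=\mathcal X\cap\{x: Ax\le c\}$; it is compact, with $\overline{\mathcal X}\subseteq\prod_{i\in[n]}[\underline x_i,\max_{j\in[m]}c_j]$. Strong concavity. A differentiable function $g$ is $\mu$-strongly concave over a domain $D$ if $\mu>0$ and $\langle\nabla g(x_2)-\nabla g(x_1),x_1-x_2\rangle\ge\mu\|x_1-x_2\|^2$ for all $x_1,x_2\in D$. Standing assumptions. (1) For every $i\in[n]$, $f_i$ is $\mu_i$-strongly concave over $\overline{\mathcal X}$ (that is, in the variable $x_i$ as $x$ ranges over $\overline{\mathcal X}$). Put $\mu=\min_{i\in[n]}\mu_i$. (2) (Slater) There is $\tilde x$ in the relative interior of $\mathcal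 X$ with $A\tilde x<c$. (3) There is a bound $\overline\lambda$ (the same for all constraints) such that for every $j\in[m]$: whenever a dual vector $\lambda^t\in\mathbb R_+^m$ has $\lambda_j^t=\overline\lambda$, the users' response $x^t$ to $\lambda^t$ (defined below) satisfies $[Ax^t-c]_j\le 0$. Safe Dual Gradient Method (SDGM). Inputs: step sizes $\gamma_-^t$, $\gamma_+^t$ and safety margin vectors $\Delta^t\in\mathbb R_+^m$, $t\ge1$. Initialize $\lambda_j^1=\overline\lambda$ for all $j\in[m]$. For $t=1,2,\dots$: - each user $i\in[n]$ receives the price $p_i^t=[A^T\lambda^t]_i$ and responds with $x_i^t=\arg\max_{x_i\in\mathcal X_i}\, f_i(x_i)-p_i^tx_i$ (the maximizers are taken to exist); - for each $j\in[m]$ the dual variable is updated by $$\lambda_j^{t+1}=\max\{0,\lambda_j^t-\gamma_-^t\}\ \text{ if } [Ax^t+\Delta^t-c]_j<0,\qquad \lambda_j^{t+1}=\min\{\overline\lambda,\lambda_j^t+\gamma_+^t\}\ \text{ if } [Ax^t+\Delta^t-c]_j\ge 0 .$$ *)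

theory Defs
  imports "HOL-Analysis.Analysis"
begin

text \<open>
  Users are indexed by the finite type \<open>'n\<close> and links (constraints) by the finite type \<open>'m\<close>.
  An upper bound of \<open>\<infinity>\<close> gives a half-line.
\<close>

definition user_domain :: "real^'n \<Rightarrow> ('n \<Rightarrow> ereal) \<Rightarrow> 'n \<Rightarrow> real set" where
  "user_domain lo up i = {z. lo $ i \<le> z \<and> ereal z \<le> up i}"

definition domain_box :: "real^'n \<Rightarrow> ('n \<Rightarrow> ereal) \<Rightarrow> (real^'n) set" where
  "domain_box lo up = {x. \<forall>i. x $ i \<in> user_domain lo up i}"

definition feasible_region ::
  "real^'n^'m \<Rightarrow> real^'m \<Rightarrow> real^'n \<Rightarrow> ('n \<Rightarrow> ereal) \<Rightarrow> (real^'n) set" where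
  "feasible_region A c lo up = domain_box lo up \<inter> {x. \<forall>j. (A *v x) $ j \<le> c $ j}"

definition total_utility :: "('n::finite \<Rightarrow> real \<Rightarrow> real) \<Rightarrow> real^'n \<Rightarrow> real" where
  "total_utility f x = (\<Sum>i\<in>UNIV. f i (x $ i))"

definition optimal_value ::
  "('n::finite \<Rightarrow> real \<Rightarrow> real) \<Rightarrow> real^'n^'m \<Rightarrow> real^'m \<Rightarrow> real^'n \<Rightarrow> ('n \<Rightarrow> ereal) \<Rightarrow> real" where
  "optimal_value f A c lo up = (SUP x\<in>feasible_region A c lo up. total_utility f x)"

text \<open>
  The gradient is taken within the domain \<open>S\<close> of \<open>g\<close>, hence one-sided at the end points of an
  interval.  If \<open>S\<close> is a single point, the gradient is not unique, but then the inequality below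
  is trivial.
\<close>

definition strongly_concave_on :: "'a::real_inner set \<Rightarrow> 'a set \<Rightarrow> real \<Rightarrow> ('a \<Rightarrow> real) \<Rightarrow> bool" where
  "strongly_concave_on S D \<mu> g \<longleftrightarrow>
     \<mu> > 0 \<and>
     (\<exists>grad. (\<forall>x\<in>D. (g has_derivative (\<lambda>h. grad x \<bullet> h)) (at x within S)) \<and>
       (\<forall>x1\<in>D. \<forall>x2\<in>D. (grad x2 - grad x1) \<bullet> (x1 - x2) \<ge> \<mu> * (norm (x1 - x2))\<^sup>2))"

text \<open>
  Maximizers need not be unique outside the region of strong concavity; a response is any choice
  of maximizers.
\<close>

definition is_response ::
  "('n \<Rightarrow> real \<Rightarrow> real) \<Rightarrow> real^'n^'m \<Rightarrow> real^'n \<Rightarrow> ('n \<Rightarrow> ereal) \<Rightarrow> real^'m \<Rightarrow> real^'n \<Rightarrow> bool" where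
  "is_response f A lo up lam x \<longleftrightarrow>
     (\<forall>i. is_arg_max (\<lambda>z. f i z - (transpose A *v lam) $ i * z)
                     (\<lambda>z. z \<in> user_domain lo up i) (x $ i))"

text \<open>
  Time starts at 1; the values of all sequences at 0 are irrelevant.
\<close>

definition sdgm_run ::
  "('n \<Rightarrow> real \<Rightarrow> real) \<Rightarrow> real^'n^'m \<Rightarrow> real^'m \<Rightarrow> real^'n \<Rightarrow> ('n \<Rightarrow> ereal) \<Rightarrow> real \<Rightarrow>
   (nat \<Rightarrow> real) \<Rightarrow> (nat \<Rightarrow> real) \<Rightarrow> (nat \<Rightarrow> real^'m) \<Rightarrow>
   (nat \<Rightarrow> real^'m) \<Rightarrow> (nat \<Rightarrow> real^'n) \<Rightarrow> bool" where
  "sdgm_run f A c lo up lam_max step_dn step_up margin lam x \<longleftrightarrow>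
     (\<forall>j. lam 1 $ j = lam_max) \<and>
     (\<forall>t\<ge>1. is_response f A lo up (lam t) (x t) \<and>
       (\<forall>j. lam (Suc t) $ j =
          (if (A *v x t + margin t - c) $ j < 0
           then max 0 (lam t $ j - step_dn t)
           else min lam_max (lam t $ j + step_up t))))"

definition norm1 :: "real^'k \<Rightarrow> real" where
  "norm1 v = (\<Sum>k\<in>UNIV. \<bar>v $ k\<bar>)"

text \<open>
  Eigenvalues are taken over the complex numbers; the set of eigenvalues is finite and nonempty,
  so that the supremum is a maximum.
\<close>

definition spectral_radius :: "real^'k^'k \<Rightarrow> real" where
  "spectral_radius M =
     (SUP k\<in>{k. \<exists>v. v \<noteq> 0 \<and> map_matrix complex_of_real M *v v = k *s v}. cmod k)"

end

theory Submission
  imports Defs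
begin

text \<open>
  Feasibility. Strong concavity bounds how far a response can move when prices drop, and the margin
  is exactly the resulting bound on the change of load of a link whose multiplier decreases. A
  multiplier that increases does so by enough to outweigh all decreases, so no user of its link sees
  a lower price. Since strong concavity is available only on the feasible region, one moves from
  \<open>x\<^sup>t\<close> to \<open>x\<^sup>t\<^sup>+\<^sup>1\<close> along a segment: as long as the moving point is feasible, every constraint whose
  new multiplier is below the cap is strict, so by connectedness the point never leaves the region.

  Regret. By weak duality the regret of a step is at most \<open>\<Sum>\<^sub>j \<lambda>\<^sub>j s\<^sub>j\<close> with \<open>s = c - A x\<^sup>t\<close>, and \<open>s\<close> is
  the gradient of the dual function \<open>D\<close>. A link whose multiplier decreases contributes to a decrease
  of \<open>D\<close> by about \<open>\<gamma>\<^sub>- s\<^sub>j\<close>; a link whose multiplier increases has \<open>s\<^sub>j\<close> below its margin. The first-order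
  and second-order cost of the increases is amortised against \<open>\<Sum>\<^sub>t (\<lambda>\<^sub>j\<^sup>t\<^sup>+\<^sup>1 - \<lambda>\<^sub>j\<^sup>t) \<le> 0\<close>. This yields the
  bound even without the spectral radius term of the constant.
\<close>

subsection \<open>Concave functions of one variable\<close>

text \<open>The chain rule along the segment from \<open>z\<close> to \<open>w\<close>, which
  convexity keeps inside \<open>S\<close>, turns the derivative relative to \<open>S\<close> into a
  one-sided limit. End points of \<open>S\<close> are thereby covered as well.\<close>

lemma directional_difference_quotient:
  fixes g :: "real \<Rightarrow> real"
  assumes "convex S" "z \<in> S" "w \<in> S" "(g has_derivative (\<lambda>h. d * h)) (at z within S)"
  shows "((\<lambda>s. (g (z + s * (w - z)) - g z) / s) \<longlongrightarrow> d * (w - z)) (at_right 0)"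
proof -
  have "z + s * (w - z) \<in> S" if "s \<in> {0..1}" for s
  proof -
    have "(1 - s) *\<^sub>R z + s *\<^sub>R w \<in> S"
      using assms that by (auto simp: convex_alt)
    then show ?thesis by (simp add: algebra_simps)
  qed
  then have sub: "(\<lambda>s. z + s * (w - z)) ` {0..1} \<subseteq> S" by blast
  have "((\<lambda>s. z + s * (w - z)) has_derivative (\<lambda>h. h * (w - z))) (at 0 within {0..1})"
    by (auto intro!: derivative_eq_intros)
  moreover have "(g has_derivative (\<lambda>h. d * h)) (at (z + 0 * (w - z)) within (\<lambda>s. z + s * (w - z)) ` {0..1})"
    using has_derivative_subset[OF assms(4) sub] by simp
  ultimately have "((\<lambda>s. g (z + s * (w - z))) has_derivative (\<lambda>h. d * (h * (w - z)))) (at 0 within {0..1})"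
    by (rule has_derivative_in_compose)
  then have "((\<lambda>s. g (z + s * (w - z))) has_field_derivative d * (w - z)) (at 0 within {0..1})"
    unfolding has_field_derivative_def
    by (rule has_derivative_eq_rhs) (auto simp: algebra_simps)
  then show ?thesis
    by (simp add: has_field_derivative_iff at_within_Icc_at_right)
qed

text \<open>By concavity every difference quotient with \<open>s\<close> in (0,1) is at least
  \<open>g w - g z\<close>, and the limit inherits this.\<close>

lemma concave_on_below_tangent:
  fixes g :: "real \<Rightarrow> real"
  assumes conc: "concave_on S g" and "z \<in> S" "w \<in> S"
    and der: "(g has_derivative (\<lambda>h. d * h)) (at z within S)"
  shows "g w - g z \<le> d * (w - z)"
proof (rule tendsto_lowerbound)
  show "((\<lambda>s. (g (z + s * (w - z)) - g z) / s) \<longlongrightarrow> d * (w - z)) (at_right 0)"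
    using assms by (intro directional_difference_quotient[where S = S]) (auto simp: concave_on_def convex_on_def)
  have "g w - g z \<le> (g (z + s * (w - z)) - g z) / s" if "s \<in> {0<..<1}" for s
  proof -
    have "(1 - s) * g z + s * g w \<le> g ((1 - s) *\<^sub>R z + s *\<^sub>R w)"
      using that assms by (intro concave_onD[OF conc]) auto
    then show ?thesis using that by (simp add: field_simps)
  qed
  then show "\<forall>\<^sub>F s in at_right 0. g w - g z \<le> (g (z + s * (w - z)) - g z) / s"
    by (auto simp: eventually_at_right_field intro!: exI[of _ 1])
qed simp

text \<open>Optimality bounds every difference quotient by \<open>p * (w - z)\<close>. Only an
  inequality results, since the maximizer may be an end point of \<open>S\<close>.\<close>

lemma is_arg_max_first_order:
  fixes g :: "real \<Rightarrow> real"
  assumes "convex S" "w \<in> S" and max: "is_arg_max (\<lambda>u. g u - p * u) (\<lambda>u. u \<in> S) z"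
    and der: "(g has_derivative (\<lambda>h. d * h)) (at z within S)"
  shows "d * (w - z) \<le> p * (w - z)"
proof (rule tendsto_upperbound)
  have z: "z \<in> S" and opt: "\<And>u. u \<in> S \<Longrightarrow> g u - p * u \<le> g z - p * z"
    using max by (auto simp: is_arg_max_def not_less)
  show "((\<lambda>s. (g (z + s * (w - z)) - g z) / s) \<longlongrightarrow> d * (w - z)) (at_right 0)"
    using assms z by (intro directional_difference_quotient[where S = S])
  have "(g (z + s * (w - z)) - g z) / s \<le> p * (w - z)" if s: "s \<in> {0<..<1}" for s
  proof -
    have "(1 - s) *\<^sub>R z + s *\<^sub>R w \<in> S"
      using assms s z by (auto simp: convex_alt)
    then have "z + s * (w - z) \<in> S" by (simp add: algebra_simps)
    from opt[OF this] show ?thesis using s by (simp add: field_simps)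
  qed
  then show "\<forall>\<^sub>F s in at_right 0. (g (z + s * (w - z)) - g z) / s \<le> p * (w - z)"
    by (auto simp: eventually_at_right_field intro!: exI[of _ 1])
qed simp

text \<open>
  Only \<open>a\<close> and \<open>z\<close> have to lie in the region of strong concavity \<open>D\<close>: the maximizer \<open>b\<close> for the
  second price may a priori lie outside of it.
\<close>

lemma strongly_concave_on_maximizer_shift:
  fixes g :: "real \<Rightarrow> real"
  assumes strong: "strongly_concave_on S D \<mu> g" and conc: "concave_on S g" and "D \<subseteq> S"
    and a: "is_arg_max (\<lambda>u. g u - p * u) (\<lambda>u. u \<in> S) a"
    and b: "is_arg_max (\<lambda>u. g u - q * u) (\<lambda>u. u \<in> S) b"
    and "a \<in> D" "z \<in> D" and s: "0 \<le> s" "s \<le> 1" and z: "z = a + s * (b - a)"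
  shows "\<mu> * (z - a)\<^sup>2 \<le> (p - q) * (z - a)"
proof -
  obtain grad where der: "\<And>u. u \<in> D \<Longrightarrow> (g has_derivative (\<lambda>h. grad u * h)) (at u within S)"
    and mono: "\<And>u v. u \<in> D \<Longrightarrow> v \<in> D \<Longrightarrow> (grad v - grad u) * (u - v) \<ge> \<mu> * (norm (u - v))\<^sup>2"
    using strong by (auto simp: strongly_concave_on_def)
  have S: "convex S" using conc by (auto simp: concave_on_def convex_on_def)
  have bS: "b \<in> S" and opt: "\<And>u. u \<in> S \<Longrightarrow> g u - q * u \<le> g b - q * b"
    using b by (auto simp: is_arg_max_def not_less)
  have 1: "grad a * (z - a) \<le> p * (z - a)"
    using is_arg_max_first_order[OF S _ a der] assms by blast
  \<comment> \<open>For \<open>s < 1\<close>, optimality of \<open>b\<close> and the tangent at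
    \<open>z\<close> compare \<open>q\<close> with \<open>grad z\<close> in direction
    \<open>b - z\<close>, which is parallel to \<open>z - a\<close>. For \<open>s = 1\<close> that
    direction vanishes, and the first-order condition at \<open>b = z\<close> is tested against
    \<open>a\<close> instead.\<close>
  have 2: "q * (z - a) \<le> grad z * (z - a)"
  proof (cases "s = 1")
    case True
    then have "z = b" using z by simp
    then have "grad b * (a - b) \<le> q * (a - b)"
      using is_arg_max_first_order[OF S _ b der] assms by blast
    then show ?thesis using \<open>z = b\<close> by (simp add: algebra_simps)
  next
    case False
    have zS: "z \<in> S" using assms by blast
    have "q * (b - z) \<le> g b - g z" using opt[OF zS] by (simp add: algebra_simps)
    also have "\<dots> \<le> grad z * (b - z)"
      using concave_on_below_tangent[OF conc zS bS der] assms by blast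
    finally have "s * (q * (b - z)) \<le> s * (grad z * (b - z))" using s by (intro mult_left_mono)
    moreover have "s * (b - z) = (1 - s) * (z - a)" unfolding z by (simp add: algebra_simps)
    ultimately have "(1 - s) * (q * (z - a)) \<le> (1 - s) * (grad z * (z - a))"
      by (metis mult.left_commute)
    then show ?thesis using s False by simp
  qed
  have "\<mu> * (z - a)\<^sup>2 \<le> (grad z - grad a) * (a - z)"
    using mono[of a z] assms by (simp add: power2_commute)
  also have "\<dots> = grad a * (z - a) - grad z * (z - a)" by (simp add: algebra_simps)
  also have "\<dots> \<le> p * (z - a) - q * (z - a)" using 1 2 by simp
  finally show ?thesis by (simp add: algebra_simps)
qed

lemma strongly_concave_on_antimono:
  assumes "strongly_concave_on S D \<mu> g" "0 < \<mu>'" "\<mu>' \<le> \<mu>"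
  shows "strongly_concave_on S D \<mu>' g"
proof -
  have "\<mu>' * (norm w)\<^sup>2 \<le> \<mu> * (norm w)\<^sup>2" for w :: 'a
    using assms by (intro mult_right_mono) auto
  then show ?thesis
    using assms unfolding strongly_concave_on_def by (meson order_trans)
qed

subsection \<open>Real analysis\<close>

text \<open>By \<open>improve\<close>, the points of [0,1] where all \<open>h j\<close> are
  nonpositive are those where all are negative. This set is closed and open in [0,1] and contains 0,
  so it is the whole connected interval.\<close>

lemma negative_on_unit_interval:
  fixes h :: "'j \<Rightarrow> real \<Rightarrow> real"
  assumes "finite J" and cont: "\<And>j. j \<in> J \<Longrightarrow> continuous_on UNIV (h j)"
    and start: "\<And>j. j \<in> J \<Longrightarrow> h j 0 \<le> 0"
    and improve: "\<And>s j. \<lbrakk>0 \<le> s; s \<le> 1; \<forall>k\<in>J. h k s \<le> 0; j \<in> J\<rbrakk> \<Longrightarrow> h j s < 0"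
    and s: "0 \<le> s" "s \<le> 1" "j \<in> J"
  shows "h j s < 0"
proof -
  let ?T = "{0..1} \<inter> (\<Inter>j\<in>J. {s. h j s \<le> 0})"
  have eq: "?T = {0..1} \<inter> (\<Inter>j\<in>J. {s. h j s < 0})"
    using improve by (fastforce intro: less_imp_le)
  have "closed (\<Inter>j\<in>J. {s. h j s \<le> 0})"
    using cont by (intro closed_INT ballI closed_Collect_le) auto
  then have "closedin (top_of_set {0..1}) ?T" by (rule closedin_closed_Int)
  moreover have "open (\<Inter>j\<in>J. {s. h j s < 0})"
    using cont \<open>finite J\<close> by (intro open_INT ballI open_Collect_less) auto
  then have "openin (top_of_set {0..1}) ?T" unfolding eq by (rule openin_open_Int)
  moreover have "connected {0..1::real}" by simp
  moreover have "0 \<in> ?T" using start by auto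
  ultimately have "?T = {0..1}" unfolding connected_clopen by blast
  then have "s \<in> ?T" using s by simp
  then show ?thesis using eq s by blast
qed

text \<open>Abel summation: in the inductive step the weight on the nonnegative gap
  \<open>U - E (Suc T)\<close> is raised from \<open>w T\<close> to \<open>w (Suc T)\<close>, after
  which the sum telescopes.\<close>

lemma weighted_telescoping_le:
  fixes E w :: "nat \<Rightarrow> real"
  assumes "1 \<le> T" and w: "\<And>t. 1 \<le> t \<Longrightarrow> 0 \<le> w t" "\<And>t. 1 \<le> t \<Longrightarrow> w t \<le> w (Suc t)"
    and E: "\<And>t. 1 \<le> t \<Longrightarrow> t \<le> T \<Longrightarrow> E t \<le> U"
  shows "(\<Sum>t=1..T. w t * (E t - E (Suc t))) \<le> w T * (U - E (Suc T))"
  using \<open>1 \<le> T\<close> E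
proof (induction T rule: dec_induct)
  case base
  then show ?case using w(1)[of 1] by (auto intro!: mult_left_mono)
next
  case (step T)
  have "(\<Sum>t=1..Suc T. w t * (E t - E (Suc t)))
      \<le> w T * (U - E (Suc T)) + w (Suc T) * (E (Suc T) - E (Suc (Suc T)))"
    using step by simp
  also have "\<dots> \<le> w (Suc T) * (U - E (Suc T)) + w (Suc T) * (E (Suc T) - E (Suc (Suc T)))"
    using w(2)[of T] step by (intro add_right_mono mult_right_mono) auto
  finally show ?case by (simp add: algebra_simps)
qed

lemma sum_inverse_sqrt_le: "(\<Sum>t=1..T. 1 / sqrt (real t)) \<le> 2 * sqrt (real T)"
proof (induction T)
  case (Suc T)
  let ?a = "sqrt (real T)" and ?b = "sqrt (real (Suc T))"
  \<comment> \<open>The aim is that the new summand is at most twice the increment of the square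
    root, so that the bound telescopes.\<close>
  have "1 = ?b\<^sup>2 - ?a\<^sup>2" by simp
  also have "\<dots> = (?b - ?a) * (?b + ?a)" by (simp add: power2_eq_square algebra_simps)
  also have "\<dots> \<le> (?b - ?a) * (2 * ?b)" by (intro mult_left_mono) auto
  finally have "1 \<le> 2 * (?b - ?a) * ?b" by (simp only: mult_ac)
  then have "1 / ?b \<le> 2 * (?b - ?a)" by (subst divide_le_eq) auto
  then show ?case using Suc by simp
qed simp

subsection \<open>Spectral radius\<close>

text \<open>Compare both sides of the eigenvalue equation at an entry of \<open>v\<close> of largest
  modulus. The crude bound serves to make the supremum in \<open>spectral_radius\<close> a bounded
  one.\<close>

lemma eigenvalues_bounded:
  fixes M :: "complex^'k^'k"
  assumes "v \<noteq> 0" "M *v v = k *s v"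
  shows "cmod k \<le> (\<Sum>i\<in>UNIV. \<Sum>j\<in>UNIV. cmod (M $ i $ j))"
proof -
  define r where "r = Max (range (\<lambda>i. cmod (v $ i)))"
  have "r \<in> range (\<lambda>i. cmod (v $ i))" unfolding r_def by (intro Max_in) auto
  then obtain i where i: "r = cmod (v $ i)" by blast
  have le: "cmod (v $ j) \<le> r" for j unfolding r_def by (intro Max_ge) auto
  obtain j where "v $ j \<noteq> 0" using assms(1) by (auto simp: vec_eq_iff)
  then have "0 < r" using le[of j] by (meson less_le_trans zero_less_norm_iff)
  have "cmod k * r = cmod ((M *v v) $ i)" by (simp add: assms i norm_mult)
  also have "\<dots> \<le> (\<Sum>j\<in>UNIV. cmod (M $ i $ j) * cmod (v $ j))"
    unfolding matrix_vector_mult_def by (auto intro!: sum_norm_le simp: norm_mult)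
  also have "\<dots> \<le> (\<Sum>j\<in>UNIV. cmod (M $ i $ j) * r)"
    using le by (intro sum_mono mult_left_mono) auto
  also have "\<dots> = (\<Sum>j\<in>UNIV. cmod (M $ i $ j)) * r" by (simp add: sum_distrib_right)
  also have "\<dots> \<le> (\<Sum>i\<in>UNIV. \<Sum>j\<in>UNIV. cmod (M $ i $ j)) * r"
    using \<open>0 < r\<close> by (intro mult_right_mono member_le_sum[where f = "\<lambda>i. \<Sum>j\<in>UNIV. cmod (M $ i $ j)"]) (auto intro: sum_nonneg)
  finally show ?thesis using \<open>0 < r\<close> by simp
qed

text \<open>Rayleigh quotient: a maximizer \<open>v\<close> of the norm of \<open>A *v v\<close> on
  the unit sphere is an eigenvector, because its residual \<open>w\<close> would otherwise be a
  direction of ascent.\<close>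

lemma gram_matrix_eigenvector:
  fixes A :: "real^'n^'m"
  obtains v r where "v \<noteq> 0" "(transpose A ** A) *v v = r *\<^sub>R v"
proof -
  have "compact (sphere (0::real^'n) 1)" "sphere (0::real^'n) 1 \<noteq> {}" by auto
  moreover have "continuous_on (sphere 0 1) (\<lambda>v. (norm (A *v v))\<^sup>2)"
    by (intro continuous_intros linear_continuous_on matrix_vector_mul_bounded_linear)
  ultimately have "\<exists>v\<in>sphere 0 1. \<forall>u\<in>sphere 0 1. (norm (A *v u))\<^sup>2 \<le> (norm (A *v v))\<^sup>2"
    by (rule continuous_attains_sup)
  then obtain v where v: "norm v = 1"
    and max: "\<And>u. norm u = 1 \<Longrightarrow> (norm (A *v u))\<^sup>2 \<le> (norm (A *v v))\<^sup>2"
    by auto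
  define r where "r = (norm (A *v v))\<^sup>2"
  define w where "w = (transpose A ** A) *v v - r *\<^sub>R v"
  have le: "(norm (A *v u))\<^sup>2 \<le> r * (norm u)\<^sup>2" for u
  proof (cases "u = 0")
    case False
    have "A *v u = norm u *\<^sub>R (A *v (u /\<^sub>R norm u))"
      using False by (simp add: matrix_vector_mult_scaleR)
    then have "(norm (A *v u))\<^sup>2 = (norm u)\<^sup>2 * (norm (A *v (u /\<^sub>R norm u)))\<^sup>2"
      by (metis norm_scaleR abs_norm_cancel power_mult_distrib)
    also have "\<dots> \<le> (norm u)\<^sup>2 * r"
      unfolding r_def using False by (intro mult_left_mono max) auto
    finally show ?thesis by (simp add: mult.commute)
  qed simp
  have adj: "(A *v v) \<bullet> (A *v u) = ((transpose A ** A) *v v) \<bullet> u" for u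
    by (simp add: dot_lmul_matrix[symmetric] transpose_matrix_vector[symmetric] matrix_vector_mul_assoc)
  define \<beta> where "\<beta> = r * (norm w)\<^sup>2 - (norm (A *v w))\<^sup>2"
  \<comment> \<open>Insert \<open>v + s *\<^sub>R w\<close> into \<open>le\<close>: the constant
    terms and the terms with \<open>v \<bullet> w\<close> cancel.\<close>
  have quad: "2 * s * (norm w)\<^sup>2 \<le> s\<^sup>2 * \<beta>" for s
  proof -
    have "(norm (A *v (v + s *\<^sub>R w)))\<^sup>2 \<le> r * (norm (v + s *\<^sub>R w))\<^sup>2" by (rule le)
    moreover have "(norm (A *v (v + s *\<^sub>R w)))\<^sup>2
        = r + 2 * s * (((transpose A ** A) *v v) \<bullet> w) + s\<^sup>2 * (norm (A *v w))\<^sup>2"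
      unfolding adj[symmetric] r_def power2_norm_eq_inner matrix_vector_right_distrib matrix_vector_mult_scaleR
      by (simp add: inner_add_left inner_add_right inner_commute power2_eq_square algebra_simps)
    moreover have "(norm (v + s *\<^sub>R w))\<^sup>2 = 1 + 2 * s * (v \<bullet> w) + s\<^sup>2 * (norm w)\<^sup>2"
      using v unfolding power2_norm_eq_inner norm_eq_1
      by (simp add: inner_add_left inner_add_right inner_commute power2_eq_square algebra_simps)
    moreover have "((transpose A ** A) *v v) \<bullet> w = (norm w)\<^sup>2 + r * (v \<bullet> w)"
      unfolding power2_norm_eq_inner by (subst (2) w_def) (simp add: inner_diff_left)
    ultimately show ?thesis unfolding \<beta>_def by (simp add: algebra_simps)
  qed
  have "w = 0"
  proof (rule ccontr)
    assume "w \<noteq> 0"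
    then have pos: "0 < (norm w)\<^sup>2" by simp
    have "2 * (norm w)\<^sup>2 \<le> \<beta>" using quad[of 1] by simp
    then have "0 < \<beta>" using pos by linarith
    \<comment> \<open>This \<open>s\<close> minimizes right side minus left side of
      \<open>quad\<close>.\<close>
    have "2 * ((norm w)\<^sup>2 / \<beta>) * (norm w)\<^sup>2 \<le> ((norm w)\<^sup>2 / \<beta>)\<^sup>2 * \<beta>" by (rule quad)
    then have "2 * (norm w)\<^sup>2 * (norm w)\<^sup>2 \<le> (norm w)\<^sup>2 * (norm w)\<^sup>2"
      using \<open>0 < \<beta>\<close> by (simp add: field_simps power2_eq_square)
    then show False using mult_pos_pos[OF pos pos] by linarith
  qed
  then have "(transpose A ** A) *v v = r *\<^sub>R v" by (simp add: w_def)
  moreover have "v \<noteq> 0" using v by auto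
  ultimately show ?thesis using that by blast
qed

text \<open>The eigenvalue is needed because the supremum of an empty set of reals is unspecified.\<close>

lemma spectral_radius_gram_nonneg:
  fixes A :: "real^'n^'m"
  shows "0 \<le> spectral_radius (transpose A ** A)"
proof -
  obtain v r where v: "v \<noteq> 0" "(transpose A ** A) *v v = r *\<^sub>R v"
    by (rule gram_matrix_eigenvector)
  define u where "u = (\<chi> i. complex_of_real (v $ i))"
  let ?K = "{k. \<exists>v. v \<noteq> 0 \<and> map_matrix complex_of_real (transpose A ** A) *v v = k *s v}"
  have "u \<noteq> 0" using v by (auto simp: u_def vec_eq_iff)
  moreover have "map_matrix complex_of_real (transpose A ** A) *v u = complex_of_real r *s u"
  proof (subst vec_eq_iff, intro allI)
    fix i
    have "(map_matrix complex_of_real (transpose A ** A) *v u) $ i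
        = complex_of_real (((transpose A ** A) *v v) $ i)"
      by (simp add: matrix_vector_mult_def map_matrix_def u_def)
    also have "\<dots> = (complex_of_real r *s u) $ i"
      unfolding v by (simp add: u_def)
    finally show "(map_matrix complex_of_real (transpose A ** A) *v u) $ i
        = (complex_of_real r *s u) $ i" .
  qed
  ultimately have "complex_of_real r \<in> ?K" by blast
  moreover have "bdd_above (cmod ` ?K)"
    by (rule bdd_aboveI2) (auto dest: eigenvalues_bounded)
  ultimately have "cmod (complex_of_real r) \<le> spectral_radius (transpose A ** A)"
    unfolding spectral_radius_def by (rule cSUP_upper)
  then show ?thesis by (meson norm_ge_zero order_trans)
qed

subsection \<open>Responses and duality\<close>

locale network =
  fixes A :: "real^'n^'m" and c :: "real^'m" and lo :: "real^'n" and up :: "'n \<Rightarrow> ereal"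
    and f :: "'n \<Rightarrow> real \<Rightarrow> real" and \<mu> :: real
  assumes A01: "\<And>j i. A $ j $ i \<in> {0, 1}"
    and c_nonneg: "\<And>j. 0 \<le> c $ j"
    and lo_nonneg: "\<And>i. 0 \<le> lo $ i"
    and f_concave: "\<And>i. concave_on (user_domain lo up i) (f i)"
    and f_strong: "\<And>i. strongly_concave_on (user_domain lo up i)
                     ((\<lambda>y. y $ i) ` feasible_region A c lo up) \<mu> (f i)"
begin

declare transpose_matrix_vector [simp del]

abbreviation "feas \<equiv> feasible_region A c lo up"
abbreviation "response \<equiv> is_response f A lo up"

text \<open>As \<open>A\<close> has entries 0 and 1, this counts the links used by user
  \<open>i\<close>.\<close>

definition degree :: "'n \<Rightarrow> real" where
  "degree i = (transpose A *v (\<chi> k. 1)) $ i"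

text \<open>The safety margin per unit of step size: between feasible responses, the load of link
  \<open>j\<close> grows by at most this much if no multiplier drops by more than 1.\<close>

definition sensitivity :: "'m \<Rightarrow> real" where
  "sensitivity j = ((A ** transpose A) *v (\<chi> k. 1)) $ j / \<mu>"

text \<open>At a response to \<open>l\<close> this is the dual function at \<open>l\<close>. Keeping
  \<open>y\<close> as an argument allows one point to be compared under two multipliers.\<close>

definition lagrangian :: "real^'m \<Rightarrow> real^'n \<Rightarrow> real" where
  "lagrangian l y = total_utility f y + l \<bullet> (c - A *v y)"

lemma mu_pos: "0 < \<mu>"
  using f_strong by (auto simp: strongly_concave_on_def)

lemma A_nonneg: "0 \<le> A $ j $ i" and A_idem: "A $ j $ i * (A $ j $ i * r) = A $ j $ i * r"
  and A_square: "(A $ j $ i)\<^sup>2 = A $ j $ i"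
  using A01[of j i] by auto

lemma price_eq: "(transpose A *v l) $ i = (\<Sum>j\<in>UNIV. A $ j $ i * l $ j)"
  by (simp add: matrix_vector_mult_def transpose_def)

lemma degree_eq: "degree i = (\<Sum>j\<in>UNIV. A $ j $ i)"
  by (simp add: degree_def price_eq)

lemma degree_nonneg: "0 \<le> degree i"
  by (simp add: degree_eq sum_nonneg A_nonneg)

lemma sensitivity_eq: "sensitivity j = (\<Sum>i\<in>UNIV. A $ j $ i * degree i) / \<mu>"
  unfolding sensitivity_def degree_def matrix_vector_mul_assoc[symmetric]
  by (simp add: matrix_vector_mult_def)

lemma sensitivity_nonneg: "0 \<le> sensitivity j"
  unfolding sensitivity_eq using mu_pos by (intro divide_nonneg_pos sum_nonneg mult_nonneg_nonneg A_nonneg degree_nonneg)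

text \<open>Double counting over links and users gives each user the square of its degree. This is
  the source of the norm term in the constant \<open>C\<close>.\<close>

lemma sum_sensitivity: "(\<Sum>j\<in>UNIV. sensitivity j) = (norm (transpose A *v (\<chi> k. 1)))\<^sup>2 / \<mu>"
proof -
  have "(\<Sum>j\<in>UNIV. \<Sum>i\<in>UNIV. A $ j $ i * degree i) = (\<Sum>i\<in>UNIV. \<Sum>j\<in>UNIV. A $ j $ i * degree i)"
    by (rule sum.swap)
  also have "\<dots> = (\<Sum>i\<in>UNIV. degree i * degree i)"
    by (simp add: degree_eq sum_distrib_right)
  also have "\<dots> = (norm (transpose A *v (\<chi> k. 1)))\<^sup>2"
    by (simp add: power2_norm_eq_inner inner_vec_def degree_def)
  finally show ?thesis by (simp add: sensitivity_eq sum_divide_distrib[symmetric])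
qed

lemma user_domain_convex: "convex (user_domain lo up i)"
  using f_concave[of i] by (auto simp: concave_on_def convex_on_def)

lemma domain_box_segment:
  assumes "0 \<le> s" "s \<le> 1" "y \<in> domain_box lo up" "z \<in> domain_box lo up"
  shows "y + s *\<^sub>R (z - y) \<in> domain_box lo up"
proof -
  have "(1 - s) *\<^sub>R y $ i + s *\<^sub>R z $ i \<in> user_domain lo up i" for i
    using assms user_domain_convex[of i] by (auto simp: convex_alt domain_box_def)
  then show ?thesis by (simp add: domain_box_def algebra_simps)
qed

lemma feas_iff: "y \<in> feas \<longleftrightarrow> y \<in> domain_box lo up \<and> (\<forall>j. (A *v y) $ j \<le> c $ j)"
  by (auto simp: feasible_region_def)

lemma response_box: "response l y \<Longrightarrow> y \<in> domain_box lo up"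
  by (auto simp: is_response_def is_arg_max_def domain_box_def)

lemma feas_load_nonneg:
  assumes "y \<in> feas"
  shows "0 \<le> (A *v y) $ j"
proof -
  have "lo $ i \<le> y $ i" for i
    using assms by (simp add: feas_iff domain_box_def user_domain_def)
  then have "0 \<le> y $ i" for i
    using lo_nonneg order_trans by blast
  then show ?thesis
    by (simp add: matrix_vector_mult_def sum_nonneg A_nonneg)
qed

text \<open>The point reached after a fraction \<open>s\<close> of the move must be feasible, but
  \<open>y'\<close> need not be. This is what lets a continuity argument establish feasibility of
  \<open>y'\<close>.\<close>

lemma response_shift:
  assumes "response l y" "response l' y'" "y \<in> feas" "y + s *\<^sub>R (y' - y) \<in> feas" "0 \<le> s" "s \<le> 1"
  shows "\<mu> * (s * (y' $ i - y $ i))\<^sup>2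
    \<le> ((transpose A *v l) $ i - (transpose A *v l') $ i) * (s * (y' $ i - y $ i))"
proof -
  let ?D = "(\<lambda>y. y $ i) ` feas"
  have D: "?D \<subseteq> user_domain lo up i" by (auto simp: feas_iff domain_box_def)
  have y: "y $ i \<in> ?D" using assms by blast
  have z: "(y + s *\<^sub>R (y' - y)) $ i \<in> ?D" using assms by blast
  have "\<mu> * ((y + s *\<^sub>R (y' - y)) $ i - y $ i)\<^sup>2
    \<le> ((transpose A *v l) $ i - (transpose A *v l') $ i) * ((y + s *\<^sub>R (y' - y)) $ i - y $ i)"
    using assms by (intro strongly_concave_on_maximizer_shift[OF f_strong f_concave D _ _ y z])
      (auto simp: is_response_def)
  then show ?thesis by simp
qed

section \<open>Lagrangian, weak duality and smoothness of the dual function\<close>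

lemma inner_load: "l \<bullet> (A *v y) = (\<Sum>i\<in>UNIV. (transpose A *v l) $ i * y $ i)"
  unfolding dot_lmul_matrix[symmetric] transpose_matrix_vector[symmetric] by (simp add: inner_vec_def)

text \<open>Up to the constant \<open>l \<bullet> c\<close> the Lagrangian is a sum over users, and
  each summand is maximized by that user's response.\<close>

lemma lagrangian_le_response:
  assumes "response l y" "z \<in> domain_box lo up"
  shows "lagrangian l z \<le> lagrangian l y"
proof -
  have eq: "lagrangian l w = (\<Sum>i\<in>UNIV. f i (w $ i) - (transpose A *v l) $ i * w $ i) + l \<bullet> c" for w
    by (simp add: lagrangian_def total_utility_def inner_diff_right inner_load sum_subtractf)
  have "f i (z $ i) - (transpose A *v l) $ i * z $ i \<le> f i (y $ i) - (transpose A *v l) $ i * y $ i" for i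
    using assms by (auto simp: is_response_def is_arg_max_def domain_box_def not_less)
  then show ?thesis unfolding eq by (intro add_right_mono sum_mono)
qed

lemma lagrangian_change: "lagrangian l' y = lagrangian l y + (l' - l) \<bullet> (c - A *v y)"
  by (simp add: lagrangian_def inner_diff_left)

lemma optimal_value_le_lagrangian:
  assumes "response l y" "\<And>j. 0 \<le> l $ j" "feas \<noteq> {}"
  shows "optimal_value f A c lo up \<le> lagrangian l y"
  unfolding optimal_value_def
proof (rule cSUP_least)
  fix z assume z: "z \<in> feas"
  have "0 \<le> l \<bullet> (c - A *v z)"
    using z assms by (auto simp: inner_vec_def feas_iff intro!: sum_nonneg mult_nonneg_nonneg)
  then have "total_utility f z \<le> lagrangian l z" by (simp add: lagrangian_def)
  also have "\<dots> \<le> lagrangian l y" using z assms by (intro lagrangian_le_response) (auto simp: feas_iff)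
  finally show "total_utility f z \<le> lagrangian l y" .
qed fact

text \<open>Cauchy-Schwarz after replacing each entry of \<open>A\<close> by its square, so that
  only the links of user \<open>i\<close> are counted.\<close>

lemma price_square_le:
  "((transpose A *v l) $ i)\<^sup>2 \<le> degree i * (\<Sum>j\<in>UNIV. A $ j $ i * (l $ j)\<^sup>2)"
proof -
  have "(transpose A *v l) $ i = (\<Sum>j\<in>UNIV. A $ j $ i * (A $ j $ i * l $ j))"
    by (simp add: price_eq A_idem)
  also have "(\<dots>)\<^sup>2 \<le> (\<Sum>j\<in>UNIV. (A $ j $ i)\<^sup>2) * (\<Sum>j\<in>UNIV. (A $ j $ i * l $ j)\<^sup>2)"
    by (rule Cauchy_Schwarz_ineq_sum)
  also have "(\<Sum>j\<in>UNIV. (A $ j $ i)\<^sup>2) = degree i"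
    by (simp add: degree_eq A_square)
  also have "(\<Sum>j\<in>UNIV. (A $ j $ i * l $ j)\<^sup>2) = (\<Sum>j\<in>UNIV. A $ j $ i * (l $ j)\<^sup>2)"
    by (simp add: power_mult_distrib A_square)
  finally show ?thesis .
qed

text \<open>
  Smoothness of the dual function along a step whose two responses are feasible. Keeping the
  multiplier changes separate link by link, rather than bounding them through the spectral radius,
  is what later allows large increases of a multiplier to be amortised.
\<close>

lemma dual_step:
  assumes l: "response l y" and l': "response l' y'" and y: "y \<in> feas" and y': "y' \<in> feas"
  shows "lagrangian l' y' \<le> lagrangian l y + (l' - l) \<bullet> (c - A *v y)
    + (\<Sum>j\<in>UNIV. sensitivity j * (l' $ j - l $ j)\<^sup>2)"
proof -
  let ?d = "l' - l"
  have user: "(transpose A *v ?d) $ i * (y $ i - y' $ i) \<le> ((transpose A *v ?d) $ i)\<^sup>2 / \<mu>" for i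
  proof -
    let ?w = "(transpose A *v ?d) $ i" and ?h = "y $ i - y' $ i"
    have "\<mu> * ?h\<^sup>2 \<le> ?w * ?h"
      using response_shift[OF l l' y, of 1 i] y'
      by (simp add: matrix_vector_mult_diff_distrib power2_commute algebra_simps)
    then have "\<mu> * (\<mu> * ?h\<^sup>2) \<le> \<mu> * (?w * ?h)" using mu_pos by (intro mult_left_mono) auto
    \<comment> \<open>Expanding the square and bounding its last term by strong concavity leaves
      \<open>\<mu> * (?w * ?h) \<le> ?w\<^sup>2\<close>.\<close>
    moreover have "0 \<le> (?w - \<mu> * ?h)\<^sup>2" by simp
    ultimately have "\<mu> * (?w * ?h) \<le> ?w\<^sup>2" by (simp add: power2_eq_square algebra_simps)
    then show ?thesis using mu_pos by (simp add: field_simps)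
  qed
  \<comment> \<open>Changing the multiplier at fixed \<open>y'\<close> produces the slack at
    \<open>y'\<close>; this difference is the price of replacing it by the slack at
    \<open>y\<close>.\<close>
  have "?d \<bullet> (A *v y) - ?d \<bullet> (A *v y') = (\<Sum>i\<in>UNIV. (transpose A *v ?d) $ i * (y $ i - y' $ i))"
    by (simp only: inner_load sum_subtractf right_diff_distrib)
  also have "\<dots> \<le> (\<Sum>i\<in>UNIV. ((transpose A *v ?d) $ i)\<^sup>2 / \<mu>)"
    by (intro sum_mono user)
  also have "\<dots> \<le> (\<Sum>i\<in>UNIV. (degree i * (\<Sum>j\<in>UNIV. A $ j $ i * (?d $ j)\<^sup>2)) / \<mu>)"
    using mu_pos by (intro sum_mono divide_right_mono price_square_le) auto
  also have "\<dots> = (\<Sum>i\<in>UNIV. \<Sum>j\<in>UNIV. A $ j $ i * degree i * (?d $ j)\<^sup>2 / \<mu>)"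
    by (simp add: sum_distrib_left sum_divide_distrib mult_ac)
  also have "\<dots> = (\<Sum>j\<in>UNIV. \<Sum>i\<in>UNIV. A $ j $ i * degree i * (?d $ j)\<^sup>2 / \<mu>)"
    by (rule sum.swap)
  also have "\<dots> = (\<Sum>j\<in>UNIV. sensitivity j * (?d $ j)\<^sup>2)"
    by (simp add: sensitivity_eq sum_distrib_right sum_divide_distrib)
  finally have "?d \<bullet> (c - A *v y') \<le> ?d \<bullet> (c - A *v y) + (\<Sum>j\<in>UNIV. sensitivity j * (?d $ j)\<^sup>2)"
    by (simp add: inner_diff_right)
  moreover have "lagrangian l y' \<le> lagrangian l y"
    using y' by (intro lagrangian_le_response[OF l]) (auto simp: feas_iff)
  ultimately show ?thesis unfolding lagrangian_change[of l' y' l] by simp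
qed

end

subsection \<open>The safe dual gradient method\<close>

locale sdgm = network A c lo up f \<mu>
  for A :: "real^'n^'m" and c lo up f \<mu> +
  fixes lam_max \<gamma> :: real and step_dn step_up :: "nat \<Rightarrow> real" and margin :: "nat \<Rightarrow> real^'m"
    and lam :: "nat \<Rightarrow> real^'m" and x :: "nat \<Rightarrow> real^'n"
  assumes lam_max_nonneg: "0 \<le> lam_max"
    and lam_max_safe: "\<And>j l y. \<lbrakk>\<forall>k. 0 \<le> l $ k; l $ j = lam_max; is_response f A lo up l y\<rbrakk>
                         \<Longrightarrow> (A *v y - c) $ j \<le> 0"
    and \<gamma>_pos: "0 < \<gamma>"
    and step_dn_eq: "\<And>t. 1 \<le> t \<Longrightarrow> step_dn t = \<gamma> / sqrt (real t)"
    and margin_eq: "\<And>t j. 1 \<le> t \<Longrightarrow>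
                      margin t $ j = ((A ** transpose A) *v (\<chi> k. 1)) $ j / \<mu> * step_dn t"
    and step_up_eq: "\<And>t. 1 \<le> t \<Longrightarrow> step_up t = (real CARD('m) - 1) * step_dn t"
    and run: "sdgm_run f A c lo up lam_max step_dn step_up margin lam x"
begin

lemma step_dn_pos: "1 \<le> t \<Longrightarrow> 0 < step_dn t"
  using \<gamma>_pos by (simp add: step_dn_eq)

lemma card_ge_1: "1 \<le> real CARD('m)"
  using zero_less_card_finite[where 'a = 'm] by linarith

lemma step_up_nonneg: "1 \<le> t \<Longrightarrow> 0 \<le> step_up t"
  using step_dn_pos[of t] card_ge_1 by (simp add: step_up_eq)

lemma margin_sensitivity: "1 \<le> t \<Longrightarrow> margin t $ j = sensitivity j * step_dn t"
  by (simp add: margin_eq sensitivity_def)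

lemma lam_1: "lam 1 $ j = lam_max"
  using run by (simp add: sdgm_run_def)

lemma response_x: "1 \<le> t \<Longrightarrow> response (lam t) (x t)"
  using run by (simp add: sdgm_run_def)

lemma lam_Suc: "1 \<le> t \<Longrightarrow> lam (Suc t) $ j =
    (if (A *v x t) $ j + margin t $ j < c $ j
     then max 0 (lam t $ j - step_dn t) else min lam_max (lam t $ j + step_up t))"
  using run by (simp add: sdgm_run_def)

lemma lam_bounds:
  assumes "1 \<le> t"
  shows "0 \<le> lam t $ j \<and> lam t $ j \<le> lam_max"
  using assms
proof (induction t rule: dec_induct)
  case base
  then show ?case using lam_1 lam_max_nonneg by simp
next
  case (step t)
  then show ?case
    using step_dn_pos[of t] step_up_nonneg[of t] lam_max_nonneg by (auto simp: lam_Suc)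
qed

section \<open>Feasibility of the iterates\<close>

lemma capped_safe:
  assumes "1 \<le> t" "lam t $ j = lam_max"
  shows "(A *v x t) $ j \<le> c $ j"
  using lam_max_safe[of "lam t" j "x t"] lam_bounds response_x assms by simp

text \<open>
  A tie between responses could be broken beyond the region of strong concavity only if some
  constraint is tight; the strict inequality below the cap excludes this.
\<close>

definition strictly_safe :: "nat \<Rightarrow> bool" where
  "strictly_safe t \<longleftrightarrow> x t \<in> feas \<and> (\<forall>j. lam t $ j \<noteq> lam_max \<longrightarrow> (A *v x t) $ j < c $ j)"

lemma lam_drop_le:
  assumes "1 \<le> t"
  shows "lam t $ k - lam (Suc t) $ k \<le> step_dn t"
  using assms step_dn_pos[of t] step_up_nonneg[of t] lam_bounds[of t k] by (auto simp: lam_Suc)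

lemma price_drop_le:
  assumes "1 \<le> t"
  shows "(transpose A *v lam t) $ i - (transpose A *v lam (Suc t)) $ i \<le> step_dn t * degree i"
proof -
  have "(transpose A *v lam t) $ i - (transpose A *v lam (Suc t)) $ i
      = (\<Sum>k\<in>UNIV. A $ k $ i * (lam t $ k - lam (Suc t) $ k))"
    by (simp add: price_eq sum_subtractf right_diff_distrib)
  also have "\<dots> \<le> (\<Sum>k\<in>UNIV. A $ k $ i * step_dn t)"
    using assms by (intro sum_mono mult_left_mono A_nonneg lam_drop_le)
  finally show ?thesis by (simp add: degree_eq sum_distrib_left mult.commute)
qed

text \<open>The rise \<open>(m - 1) * step_dn t\<close> of link \<open>j\<close> covers a drop of at
  most \<open>step_dn t\<close> on each of the other \<open>m - 1\<close> links.\<close>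

lemma price_drop_nonpos:
  assumes "1 \<le> t" "lam (Suc t) $ j = lam t $ j + step_up t" "A $ j $ i = 1"
  shows "(transpose A *v lam t) $ i - (transpose A *v lam (Suc t)) $ i \<le> 0"
proof -
  have "(transpose A *v lam t) $ i - (transpose A *v lam (Suc t)) $ i
      = (\<Sum>k\<in>UNIV. A $ k $ i * (lam t $ k - lam (Suc t) $ k))"
    by (simp add: price_eq sum_subtractf right_diff_distrib)
  also have "\<dots> = - step_up t + (\<Sum>k\<in>UNIV-{j}. A $ k $ i * (lam t $ k - lam (Suc t) $ k))"
    using assms by (subst sum.remove[of UNIV j]) auto
  also have "(\<Sum>k\<in>UNIV-{j}. A $ k $ i * (lam t $ k - lam (Suc t) $ k)) \<le> (\<Sum>k\<in>UNIV-{j}. step_dn t)"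
  proof (rule sum_mono)
    fix k
    show "A $ k $ i * (lam t $ k - lam (Suc t) $ k) \<le> step_dn t"
      using A01[of k i] step_dn_pos[of t] lam_drop_le[of t k] assms(1) by auto
  qed
  also have "- step_up t + (\<Sum>k\<in>UNIV-{j}. step_dn t) = 0"
    using card_ge_1 assms(1) by (simp add: step_up_eq card_Diff_singleton of_nat_diff)
  finally show ?thesis by simp
qed

text \<open>If the margin test leaves room on link \<open>j\<close>, the load grows by at most the
  margin. Otherwise its multiplier rises by the full step, so no user of the link demands more, and
  strictness carries over from \<open>x t\<close>.\<close>

lemma strictly_safe_segment:
  assumes t: "1 \<le> t" and safe: "strictly_safe t" and s: "0 \<le> s" "s \<le> 1"
    and feas: "x t + s *\<^sub>R (x (Suc t) - x t) \<in> feas" and j: "lam (Suc t) $ j \<noteq> lam_max"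
  shows "(A *v (x t + s *\<^sub>R (x (Suc t) - x t))) $ j < c $ j"
proof -
  let ?h = "\<lambda>i. s * (x (Suc t) $ i - x t $ i)"
  let ?w = "\<lambda>i. (transpose A *v lam t) $ i - (transpose A *v lam (Suc t)) $ i"
  have shift: "\<mu> * (?h i)\<^sup>2 \<le> ?w i * ?h i" for i
    using response_shift[of "lam t" "x t" "lam (Suc t)" "x (Suc t)" s i] assms response_x
    by (auto simp: strictly_safe_def)
  have h_le: "?h i \<le> r / \<mu>" if "?w i \<le> r" "0 \<le> r" for i r
  proof (cases "?h i \<le> 0")
    case True
    then show ?thesis using that mu_pos by (meson divide_nonneg_pos order_trans)
  next
    case False
    then have pos: "0 < ?h i" by simp
    have "(\<mu> * ?h i) * ?h i \<le> ?w i * ?h i" using shift[of i] by (simp only: power2_eq_square mult_ac)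
    then have "\<mu> * ?h i \<le> ?w i" using pos by (rule mult_right_le_imp_le)
    then show ?thesis using that mu_pos by (simp add: field_simps)
  qed
  have load: "(A *v (x t + s *\<^sub>R (x (Suc t) - x t))) $ j = (A *v x t) $ j + (\<Sum>i\<in>UNIV. A $ j $ i * ?h i)"
    by (simp add: matrix_vector_mult_def sum.distrib[symmetric] algebra_simps)
  show ?thesis
  proof (cases "(A *v x t) $ j + margin t $ j < c $ j")
    case True
    have "?h i \<le> step_dn t * degree i / \<mu>" for i
      using price_drop_le[OF t, of i] degree_nonneg[of i] step_dn_pos[OF t] by (intro h_le) auto
    then have "(\<Sum>i\<in>UNIV. A $ j $ i * ?h i) \<le> (\<Sum>i\<in>UNIV. A $ j $ i * (step_dn t * degree i / \<mu>))"
      by (intro sum_mono mult_left_mono A_nonneg)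
    also have "\<dots> = margin t $ j"
      using t by (simp add: margin_sensitivity sensitivity_eq sum_distrib_left sum_distrib_right sum_divide_distrib mult_ac)
    finally show ?thesis using True load by simp
  next
    case False
    \<comment> \<open>A new multiplier different from the cap rules out truncation, and as the step
      is nonnegative the old one was below the cap too.\<close>
    then have up: "lam (Suc t) $ j = lam t $ j + step_up t" "lam t $ j \<noteq> lam_max"
      using j t lam_Suc[OF t, of j] step_up_nonneg[OF t] by (auto simp: min_def split: if_splits)
    have "A $ j $ i * ?h i \<le> 0" for i
    proof (cases "A $ j $ i = 1")
      case True
      then show ?thesis using h_le[of i 0] price_drop_nonpos[OF t up(1) True] by simp
    next
      case False
      then show ?thesis using A01[of j i] by simp
    qed
    then have "(\<Sum>i\<in>UNIV. A $ j $ i * ?h i) \<le> 0" by (intro sum_nonpos)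
    moreover have "(A *v x t) $ j < c $ j" using safe up by (simp add: strictly_safe_def)
    ultimately show ?thesis using load by simp
  qed
qed

lemma strictly_safe_Suc:
  assumes t: "1 \<le> t" and safe: "strictly_safe t"
  shows "strictly_safe (Suc t)"
proof -
  define y where "y = (\<lambda>s. x t + s *\<^sub>R (x (Suc t) - x t))"
  define J where "J = {j. lam (Suc t) $ j \<noteq> lam_max}"
  have box: "y s \<in> domain_box lo up" if "0 \<le> s" "s \<le> 1" for s
    unfolding y_def using that t by (intro domain_box_segment response_box[OF response_x]) auto
  have affine: "(A *v y s) $ j = (1 - s) * (A *v x t) $ j + s * (A *v x (Suc t)) $ j" for s j
    by (simp add: y_def matrix_vector_right_distrib matrix_vector_mult_scaleR
        matrix_vector_mult_diff_distrib algebra_simps)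
  have feas: "y s \<in> feas" if s: "0 \<le> s" "s \<le> 1" and le: "\<forall>j\<in>J. (A *v y s) $ j \<le> c $ j" for s
  proof -
    \<comment> \<open>A link capped at time \<open>Suc t\<close> is safe at both ends of the
      segment, and its load is affine in between. Only the links in \<open>J\<close> need the
      continuity argument.\<close>
    have "(A *v y s) $ j \<le> c $ j" if "j \<notin> J" for j
    proof -
      have "(A *v x t) $ j \<le> c $ j" using safe by (auto simp: strictly_safe_def feas_iff)
      moreover have "(A *v x (Suc t)) $ j \<le> c $ j"
        using capped_safe[of "Suc t" j] that by (simp add: J_def)
      ultimately show ?thesis unfolding affine using s by (intro convex_bound_le) auto
    qed
    then show ?thesis using le box[OF s] by (auto simp: feas_iff)
  qed
  have strict: "(A *v y s) $ j - c $ j < 0" if "0 \<le> s" "s \<le> 1" "j \<in> J" for s j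
  proof (rule negative_on_unit_interval[where J = J and h = "\<lambda>j s. (A *v y s) $ j - c $ j"])
    show "continuous_on UNIV (\<lambda>s. (A *v y s) $ k - c $ k)" for k
      unfolding affine by (intro continuous_intros)
    show "(A *v y 0) $ k - c $ k \<le> 0" for k
      using safe by (simp add: affine strictly_safe_def feas_iff)
    fix s k assume "0 \<le> s" "s \<le> 1" "\<forall>k\<in>J. (A *v y s) $ k - c $ k \<le> 0" "k \<in> J"
    then have "(A *v y s) $ k < c $ k"
      using feas[of s] strictly_safe_segment[OF t safe, of s k] by (simp add: y_def J_def)
    then show "(A *v y s) $ k - c $ k < 0" by simp
  qed (use that in auto)
  have "\<forall>j\<in>J. (A *v y 1) $ j < c $ j" using strict[of 1] by simp
  moreover have "y 1 = x (Suc t)" by (simp add: y_def)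
  ultimately show ?thesis
    using feas[of 1] by (auto simp: strictly_safe_def J_def intro: less_imp_le)
qed

text \<open>Starting all multipliers at the cap makes the first response feasible and the strictness
  condition vacuous.\<close>

lemma strictly_safe: "1 \<le> t \<Longrightarrow> strictly_safe t"
proof (induction t rule: dec_induct)
  case base
  then show ?case
    using capped_safe[of 1] lam_1 response_box[OF response_x[of 1]] by (auto simp: strictly_safe_def feas_iff)
qed (rule strictly_safe_Suc)

lemma x_feas: "1 \<le> t \<Longrightarrow> x t \<in> feas"
  using strictly_safe by (simp add: strictly_safe_def)

section \<open>Regret bound\<close>

definition slack :: "nat \<Rightarrow> real^'m" where
  "slack t = c - A *v x t"

definition dual :: "nat \<Rightarrow> real" where
  "dual t = lagrangian (lam t) (x t)"

lemma slack_bounds: "1 \<le> t \<Longrightarrow> 0 \<le> slack t $ j \<and> slack t $ j \<le> c $ j"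
  using x_feas[of t] feas_load_nonneg[of "x t" j] by (simp add: slack_def feas_iff)

text \<open>The response \<open>x t\<close> competes against \<open>x u\<close> under
  \<open>lam u\<close>, so the difference is at most
  \<open>(lam t - lam u) \<bullet> slack t\<close>.\<close>

lemma dual_diff_le:
  assumes "1 \<le> t" "1 \<le> u"
  shows "dual t - dual u \<le> lam_max * norm1 c"
proof -
  have "lagrangian (lam u) (x t) \<le> dual u"
    unfolding dual_def using assms by (intro lagrangian_le_response response_x response_box[OF response_x])
  then have "dual t - dual u \<le> (lam t - lam u) \<bullet> slack t"
    using lagrangian_change[of "lam u" "x t" "lam t"] by (simp add: dual_def slack_def inner_diff_left)
  also have "\<dots> \<le> (\<Sum>j\<in>UNIV. lam_max * c $ j)"
    unfolding inner_vec_def inner_real_def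
  proof (rule sum_mono)
    fix j
    have "(lam t - lam u) $ j \<le> lam_max"
      using lam_bounds[OF assms(1), of j] lam_bounds[OF assms(2), of j] by simp
    then show "(lam t - lam u) $ j * slack t $ j \<le> lam_max * c $ j"
      using slack_bounds[OF assms(1), of j] lam_max_nonneg by (intro mult_mono) auto
  qed
  finally show ?thesis by (simp add: norm1_def sum_distrib_left c_nonneg)
qed

text \<open>
  The last summand telescopes to something nonpositive, because every multiplier starts at its
  cap. It pays for the increases, which may be \<open>m - 1\<close> times as large as a decrease.
\<close>

lemma link_regret:
  fixes t j
  defines "\<delta> \<equiv> lam (Suc t) $ j - lam t $ j" and "g \<equiv> step_dn t" and "m \<equiv> real CARD('m)"
  assumes t: "1 \<le> t"
  shows "lam t $ j * slack t $ j + lam_max * (\<delta> * slack t $ j + sensitivity j * \<delta>\<^sup>2) / g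
    \<le> g * c $ j + lam_max * sensitivity j * (m * g + (m - 1) * \<delta>)"
    (is "?L + lam_max * (\<delta> * ?s + ?K * \<delta>\<^sup>2) / g \<le> _")
proof -
  have g: "0 < g" using step_dn_pos[OF t] by (simp add: g_def)
  have m: "1 \<le> m" using card_ge_1 by (simp add: m_def)
  note s = slack_bounds[OF t, of j] and K = sensitivity_nonneg[of j] and lam = lam_bounds[OF t, of j]
  show ?thesis
  proof (cases "(A *v x t) $ j + margin t $ j < c $ j")
    case True
    have \<delta>: "\<delta> = max 0 (lam t $ j - g) - lam t $ j"
      using True lam_Suc[OF t, of j] by (simp add: \<delta>_def g_def)
    then have \<delta>_bounds: "- g \<le> \<delta>" "\<delta> \<le> 0" using g lam by auto
    have "?L + lam_max * (\<delta> * ?s) / g \<le> g * c $ j"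
    \<comment> \<open>A full decrease by \<open>g\<close> yields \<open>- lam_max * ?s\<close>,
      which pays for \<open>?L\<close>. A decrease truncated at 0 means that
      \<open>lam t $ j\<close> is below \<open>g\<close>, so \<open>?L\<close> is itself
      small.\<close>
    proof (cases "g \<le> lam t $ j")
      case True
      then have "\<delta> = - g" by (simp add: \<delta>)
      then have "?L + lam_max * (\<delta> * ?s) / g = (lam t $ j - lam_max) * ?s"
        using g by (simp add: field_simps)
      also have "\<dots> \<le> 0" using lam s by (intro mult_nonpos_nonneg) auto
      also have "0 \<le> g * c $ j" using g c_nonneg by simp
      finally show ?thesis .
    next
      case False
      then have "?L \<le> g * c $ j" using s lam by (intro mult_mono) auto
      moreover have "lam_max * (\<delta> * ?s) / g \<le> 0"
        using g s \<delta>_bounds lam_max_nonneg by (intro divide_nonpos_pos mult_nonneg_nonpos mult_nonpos_nonneg) auto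
      ultimately show ?thesis by simp
    qed
    moreover have "\<delta>\<^sup>2 / g \<le> m * g + (m - 1) * \<delta>"
    proof -
      have "\<delta>\<^sup>2 \<le> g * (- \<delta>)"
        using mult_right_mono[of "- \<delta>" g "- \<delta>"] \<delta>_bounds by (simp add: power2_eq_square)
      then have "\<delta>\<^sup>2 / g \<le> - \<delta>" using g by (simp add: field_simps)
      moreover have "0 \<le> m * (g + \<delta>)" using m \<delta>_bounds by simp
      ultimately show ?thesis by (simp add: algebra_simps)
    qed
    then have "lam_max * ?K * (\<delta>\<^sup>2 / g) \<le> lam_max * ?K * (m * g + (m - 1) * \<delta>)"
      using K lam_max_nonneg by (intro mult_left_mono) auto
    ultimately show ?thesis using g by (simp add: field_simps)
  next
    case False
    have \<delta>: "\<delta> = min lam_max (lam t $ j + (m - 1) * g) - lam t $ j"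
      using False lam_Suc[OF t, of j] t by (simp add: \<delta>_def g_def m_def step_up_eq)
    then have \<delta>_bounds: "0 \<le> \<delta>" "\<delta> \<le> (m - 1) * g" using g m lam by auto
    have s_le: "?s \<le> ?K * g" using False margin_sensitivity[OF t, of j] by (simp add: slack_def g_def)
    have "?L \<le> lam_max * (?K * g)" using lam s s_le by (intro mult_mono) auto
    moreover have "lam_max * (\<delta> * ?s + ?K * \<delta>\<^sup>2) / g \<le> lam_max * (?K * (\<delta> + (m - 1) * \<delta>))"
    proof -
      have "\<delta> * ?s \<le> \<delta> * (?K * g)" using s_le \<delta>_bounds by (intro mult_left_mono)
      moreover have "\<delta>\<^sup>2 \<le> (m - 1) * g * \<delta>"
        unfolding power2_eq_square using \<delta>_bounds by (intro mult_right_mono)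
      then have "?K * \<delta>\<^sup>2 \<le> ?K * ((m - 1) * g * \<delta>)" using K by (intro mult_left_mono)
      ultimately have "\<delta> * ?s + ?K * \<delta>\<^sup>2 \<le> ?K * (\<delta> + (m - 1) * \<delta>) * g"
        by (simp add: algebra_simps)
      then have "lam_max * (\<delta> * ?s + ?K * \<delta>\<^sup>2) \<le> lam_max * (?K * (\<delta> + (m - 1) * \<delta>) * g)"
        using lam_max_nonneg by (rule mult_left_mono)
      then show ?thesis using g by (simp add: divide_le_eq mult.assoc)
    qed
    \<comment> \<open>One copy of \<open>\<delta>\<close> is bounded by \<open>(m - 1) * g\<close>,
      which with the \<open>g\<close> from \<open>?L\<close> makes \<open>m * g\<close>; the other
      \<open>m - 1\<close> copies are kept for telescoping.\<close>
    moreover have "lam_max * (?K * \<delta>) \<le> lam_max * (?K * ((m - 1) * g))"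
      using \<delta>_bounds K lam_max_nonneg by (intro mult_left_mono)
    moreover have "0 \<le> g * c $ j" using g c_nonneg by simp
    ultimately show ?thesis by (simp add: algebra_simps)
  qed
qed

text \<open>Weak duality bounds the regret by \<open>lam t \<bullet> slack t\<close>. Adding
  \<open>dual_step\<close> scaled by \<open>lam_max / step_dn t\<close> lets
  \<open>link_regret\<close> be summed over links, at the cost of a dual difference that telescopes
  later.\<close>

lemma step_regret:
  assumes t: "1 \<le> t"
  shows "optimal_value f A c lo up - total_utility f (x t)
    \<le> step_dn t * (norm1 c + lam_max * real CARD('m) * (\<Sum>j\<in>UNIV. sensitivity j))
      + lam_max * (real CARD('m) - 1) * (\<Sum>j\<in>UNIV. sensitivity j * (lam (Suc t) $ j - lam t $ j))
      + lam_max * (dual t - dual (Suc t)) / step_dn t"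
proof -
  let ?\<delta> = "\<lambda>j. lam (Suc t) $ j - lam t $ j" and ?g = "step_dn t" and ?m = "real CARD('m)"
  have g: "0 < ?g" by (rule step_dn_pos[OF t])
  have "optimal_value f A c lo up \<le> dual t"
    unfolding dual_def using x_feas[OF t] lam_bounds[OF t] response_x[OF t]
    by (intro optimal_value_le_lagrangian) auto
  then have 1: "optimal_value f A c lo up - total_utility f (x t) \<le> (\<Sum>j\<in>UNIV. lam t $ j * slack t $ j)"
    by (simp add: dual_def lagrangian_def slack_def inner_vec_def)
  have "dual (Suc t) \<le> dual t + (\<Sum>j\<in>UNIV. ?\<delta> j * slack t $ j + sensitivity j * (?\<delta> j)\<^sup>2)"
    using dual_step[of "lam t" "x t" "lam (Suc t)" "x (Suc t)"] t response_x x_feas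
    by (simp add: dual_def slack_def inner_vec_def sum.distrib)
  then have "lam_max / ?g * (dual (Suc t) - dual t)
      \<le> lam_max / ?g * (\<Sum>j\<in>UNIV. ?\<delta> j * slack t $ j + sensitivity j * (?\<delta> j)\<^sup>2)"
    using g lam_max_nonneg by (intro mult_left_mono) auto
  also have "\<dots> = (\<Sum>j\<in>UNIV. lam_max * (?\<delta> j * slack t $ j + sensitivity j * (?\<delta> j)\<^sup>2) / ?g)"
    by (simp add: sum_distrib_left)
  also have "(\<Sum>j\<in>UNIV. lam t $ j * slack t $ j) + \<dots>
      \<le> (\<Sum>j\<in>UNIV. ?g * c $ j + lam_max * sensitivity j * (?m * ?g + (?m - 1) * ?\<delta> j))"
    unfolding sum.distrib[symmetric] by (intro sum_mono link_regret[OF t])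
  also have "\<dots> = ?g * norm1 c + lam_max * ?m * ?g * (\<Sum>j\<in>UNIV. sensitivity j)
      + lam_max * (?m - 1) * (\<Sum>j\<in>UNIV. sensitivity j * ?\<delta> j)"
  proof -
    have "?g * c $ j + lam_max * sensitivity j * (?m * ?g + (?m - 1) * ?\<delta> j)
        = ?g * c $ j + lam_max * ?m * ?g * sensitivity j + lam_max * (?m - 1) * (sensitivity j * ?\<delta> j)" for j
      by (simp add: algebra_simps)
    then show ?thesis
      by (simp only: sum.distrib sum_distrib_left[symmetric] norm1_def abs_of_nonneg[OF c_nonneg])
  qed
  finally show ?thesis using 1 by (simp add: algebra_simps diff_divide_distrib)
qed

lemma regret_le:
  assumes T: "1 \<le> T"
  shows "(\<Sum>t=1..T. optimal_value f A c lo up - total_utility f (x t))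
    \<le> lam_max\<^sup>2 * norm1 c * sqrt (real T) / \<gamma>
      + 2 * (norm1 c + lam_max * real CARD('m) * (\<Sum>j\<in>UNIV. sensitivity j)) * \<gamma> * sqrt (real T)"
proof -
  let ?C = "norm1 c + lam_max * real CARD('m) * (\<Sum>j\<in>UNIV. sensitivity j)"
  let ?\<delta> = "\<lambda>t j. lam (Suc t) $ j - lam t $ j"
  have C: "0 \<le> ?C"
    using lam_max_nonneg sensitivity_nonneg by (auto simp: norm1_def intro!: add_nonneg_nonneg mult_nonneg_nonneg sum_nonneg)
  have "(\<Sum>t=1..T. optimal_value f A c lo up - total_utility f (x t))
      \<le> (\<Sum>t=1..T. step_dn t * ?C + lam_max * (real CARD('m) - 1) * (\<Sum>j\<in>UNIV. sensitivity j * ?\<delta> t j)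
          + lam_max * (dual t - dual (Suc t)) / step_dn t)"
    by (intro sum_mono step_regret) auto
  also have "\<dots> = (\<Sum>t=1..T. step_dn t) * ?C
      + lam_max * (real CARD('m) - 1) * (\<Sum>t=1..T. \<Sum>j\<in>UNIV. sensitivity j * ?\<delta> t j)
      + (\<Sum>t=1..T. lam_max / step_dn t * (dual t - dual (Suc t)))"
    by (simp add: sum.distrib sum_distrib_left sum_distrib_right)
  also have "\<dots> \<le> 2 * ?C * \<gamma> * sqrt (real T) + 0 + lam_max\<^sup>2 * norm1 c * sqrt (real T) / \<gamma>"
  proof (intro add_mono)
    have "(\<Sum>t=1..T. step_dn t) = \<gamma> * (\<Sum>t=1..T. 1 / sqrt (real t))"
      by (simp add: step_dn_eq sum_distrib_left)
    also have "\<dots> \<le> \<gamma> * (2 * sqrt (real T))"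
      using \<gamma>_pos sum_inverse_sqrt_le by (intro mult_left_mono) auto
    finally have "(\<Sum>t=1..T. step_dn t) * ?C \<le> \<gamma> * (2 * sqrt (real T)) * ?C"
      using C by (rule mult_right_mono)
    then show "(\<Sum>t=1..T. step_dn t) * ?C \<le> 2 * ?C * \<gamma> * sqrt (real T)" by (simp only: mult_ac)
  next
    have "(\<Sum>t=1..T. \<Sum>j\<in>UNIV. sensitivity j * ?\<delta> t j) = (\<Sum>j\<in>UNIV. sensitivity j * (\<Sum>t=1..T. ?\<delta> t j))"
      by (subst sum.swap) (simp add: sum_distrib_left)
    also have "\<dots> = (\<Sum>j\<in>UNIV. sensitivity j * (lam (Suc T) $ j - lam_max))"
      using T lam_1 sum_Suc_diff[of 1 T "\<lambda>t. lam t $ j" for j] by simp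
    also have "\<dots> \<le> 0"
      using sensitivity_nonneg lam_bounds[of "Suc T"] by (intro sum_nonpos mult_nonneg_nonpos) auto
    finally show "lam_max * (real CARD('m) - 1) * (\<Sum>t=1..T. \<Sum>j\<in>UNIV. sensitivity j * ?\<delta> t j) \<le> 0"
      using lam_max_nonneg card_ge_1 by (intro mult_nonneg_nonpos mult_nonneg_nonneg) auto
  next
    \<comment> \<open>The upper bound on \<open>dual t\<close> is taken relative to the last dual
      value, so that exactly \<open>lam_max * norm1 c\<close> remains, with weight
      \<open>lam_max * sqrt T / \<gamma>\<close>.\<close>
    have "(\<Sum>t=1..T. lam_max / step_dn t * (dual t - dual (Suc t)))
        \<le> lam_max / step_dn T * ((dual (Suc T) + lam_max * norm1 c) - dual (Suc T))"
    proof (rule weighted_telescoping_le[OF T])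
      fix t :: nat assume t: "1 \<le> t"
      show "0 \<le> lam_max / step_dn t" using lam_max_nonneg step_dn_pos[OF t] by simp
      show "lam_max / step_dn t \<le> lam_max / step_dn (Suc t)"
        using lam_max_nonneg \<gamma>_pos t by (simp add: step_dn_eq divide_right_mono mult_left_mono)
      show "dual t \<le> dual (Suc T) + lam_max * norm1 c" using dual_diff_le[OF t, of "Suc T"] by simp
    qed
    then show "(\<Sum>t=1..T. lam_max / step_dn t * (dual t - dual (Suc t)))
        \<le> lam_max\<^sup>2 * norm1 c * sqrt (real T) / \<gamma>"
      using T by (simp add: step_dn_eq power2_eq_square mult_ac)
  qed
  finally show ?thesis by simp
qed

end

theorem theorem1:
  fixes A :: "real^'n^'m" and c :: "real^'m"
    and lo :: "real^'n" and up :: "'n \<Rightarrow> ereal"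
    and f :: "'n \<Rightarrow> real \<Rightarrow> real" and \<mu>s :: "'n \<Rightarrow> real" and \<mu> :: real
    and lam_max \<gamma> C :: real
    and step_dn step_up :: "nat \<Rightarrow> real" and margin :: "nat \<Rightarrow> real^'m"
    and lam :: "nat \<Rightarrow> real^'m" and x :: "nat \<Rightarrow> real^'n"
  assumes A01: "\<And>j i. A $ j $ i \<in> {0, 1}"
    and c_nonneg: "\<And>j. 0 \<le> c $ j"
    and lo_nonneg: "\<And>i. 0 \<le> lo $ i"
    and f_incr: "\<And>i. strict_mono_on (user_domain lo up i) (f i)"
    and f_concave: "\<And>i. concave_on (user_domain lo up i) (f i)"
    and f_diff: "\<And>i. f i differentiable_on user_domain lo up i"
    and feas_compact: "compact (feasible_region A c lo up)"
    and feas_bound: "\<And>y i. y \<in> feasible_region A c lo up \<Longrightarrow> y $ i \<in> {lo $ i .. (MAX j. c $ j)}"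
    and f_strong: "\<And>i. strongly_concave_on (user_domain lo up i)
                     ((\<lambda>y. y $ i) ` feasible_region A c lo up) (\<mu>s i) (f i)"
    and \<mu>_eq: "\<mu> = (MIN i. \<mu>s i)"
    and slater: "\<exists>y \<in> rel_interior (domain_box lo up). \<forall>j. (A *v y) $ j < c $ j"
    and lam_max_nonneg: "0 \<le> lam_max"
    and lam_max_safe: "\<And>j l y. \<lbrakk>\<forall>k. 0 \<le> l $ k; l $ j = lam_max; is_response f A lo up l y\<rbrakk>
                         \<Longrightarrow> (A *v y - c) $ j \<le> 0"
    and \<gamma>_pos: "0 < \<gamma>"
    and step_dn_eq: "\<And>t. 1 \<le> t \<Longrightarrow> step_dn t = \<gamma> / sqrt (real t)"
    and margin_eq: "\<And>t j. 1 \<le> t \<Longrightarrow>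
                      margin t $ j = ((A ** transpose A) *v (\<chi> k. 1)) $ j / \<mu> * step_dn t"
    and step_up_eq: "\<And>t. 1 \<le> t \<Longrightarrow> step_up t = (real CARD('m) - 1) * step_dn t"
    and run: "sdgm_run f A c lo up lam_max step_dn step_up margin lam x"
    and C_eq: "C = norm1 c + lam_max * real CARD('m) *
                 ((norm (transpose A *v (\<chi> k. 1)))\<^sup>2 +
                  spectral_radius (transpose A ** A) * (real CARD('m) - 1)\<^sup>2 / \<mu>) / \<mu>"
  shows "(\<forall>t\<ge>1. \<forall>j. (A *v x t) $ j \<le> c $ j) \<and>
         (\<forall>T\<ge>1. (\<Sum>t=1..T. optimal_value f A c lo up - total_utility f (x t))
            \<le> lam_max\<^sup>2 * norm1 c * sqrt (real T) / \<gamma> + 2 * C * \<gamma> * sqrt (real T))"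
proof -
  have \<mu>_le: "\<mu> \<le> \<mu>s i" for i
    unfolding \<mu>_eq by (intro Min_le) auto
  \<comment> \<open>The minimum is attained by some user, whose strong concavity makes it
    positive.\<close>
  have "\<mu> \<in> range \<mu>s" unfolding \<mu>_eq by (intro Min_in) auto
  then have \<mu>_pos: "0 < \<mu>" using f_strong by (auto simp: strongly_concave_on_def)
  interpret sdgm A c lo up f \<mu> lam_max \<gamma> step_dn step_up margin lam x
  proof
    show "strongly_concave_on (user_domain lo up i) ((\<lambda>y. y $ i) ` feasible_region A c lo up) \<mu> (f i)" for i
      by (rule strongly_concave_on_antimono[OF f_strong \<mu>_pos \<mu>_le])
  qed (fact A01 c_nonneg lo_nonneg f_concave lam_max_nonneg lam_max_safe \<gamma>_pos step_dn_eq margin_eq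
      step_up_eq run)+
  \<comment> \<open>This is the spectral term of \<open>C\<close>; being nonnegative, it can only
    enlarge the constant of \<open>regret_le\<close>.\<close>
  have "0 \<le> lam_max * real CARD('m) * (spectral_radius (transpose A ** A) * (real CARD('m) - 1)\<^sup>2 / \<mu>) / \<mu>"
    using lam_max_nonneg \<mu>_pos spectral_radius_gram_nonneg[of A] by simp
  then have "norm1 c + lam_max * real CARD('m) * (\<Sum>j\<in>UNIV. sensitivity j) \<le> C"
    by (simp add: C_eq sum_sensitivity distrib_left add_divide_distrib)
  then have C: "2 * (norm1 c + lam_max * real CARD('m) * (\<Sum>j\<in>UNIV. sensitivity j)) * \<gamma> * sqrt (real T)
      \<le> 2 * C * \<gamma> * sqrt (real T)" for T
    using \<gamma>_pos by (intro mult_right_mono mult_left_mono) auto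
  show ?thesis
  proof (intro conjI allI impI)
    show "(A *v x t) $ j \<le> c $ j" if "1 \<le> t" for t j
      using x_feas[OF that] by (simp add: feas_iff)
    show "(\<Sum>t=1..T. optimal_value f A c lo up - total_utility f (x t))
        \<le> lam_max\<^sup>2 * norm1 c * sqrt (real T) / \<gamma> + 2 * C * \<gamma> * sqrt (real T)" if "1 \<le> T" for T
      using regret_le[OF that] C[of T] by linarith
  qed
qed

end
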